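(* Let $R$ be an integral domain, $X$ an indeterminate over $R$, $*$ a star operation of finite character on $R[X]$, $\bar{*}$ the star operation on $R$ induced by $*$, and $Q$ a $*$-maximal ideal of $R[X]$ such that $q := Q\cap R\neq 0$. The following statements are equivalent: (i) $Q=q[X]$; (ii) $c(Q)^{\bar{*}}\subsetneq R$; (iii) $c(g)^{\bar{*}}\subsetneq R$ for each $g\in Q$.
   Context: For an integral domain $D$ with quotient field $L$, $\bar F(D)$ is the set of nonzero $D$-submodules of $L$, $F(D)$ the set of nonzero fractional ideals of $D$ (those $E\in\bar F(D)$ with $dE\subseteq D$ for some $0\ne d\in D$), and $f(D)$ the set of nonzero finitely generated $D$-submodules of $L$. A semistar operation on $D$ is a map $*:\bar F(D)\to\bar F(D)$, $E\mapsto E^*$, such that for all $E,F\in\bar F(D)$ and $0\ne a\in L$: $(aE)^*=aE^*$; $E\subseteq E^*$, and $E\subseteq F$ implies $E^*\subseteq F^*$; $E^{**}=E^*$. If $D^*=D$, the restriction of $*$ to $F(D)$ is called a star operation on $D$. A star operation is of finite character if $E^*=\bigcup\{F^* : F\in f(D), F\subseteq E\}$ for all $E\in F(D)$. A nonzero ideal $I$ is a $*$-ideal if $I=I^*$; a $*$-prime ideal is a prime ideal that is a $*$-ideal; a $*$-maximal ideal is a $*$-prime ideal that is maximal with respect to inclusion among $*$-prime ideals. Let $K$ be the quotient field of $R$. The induced operation $\bar{*}$ on $R$ is $E^{\bar{*}}=(E[X])^{*}\cap K$, where $E[X]$ is the set of polynomials with all coefficients in $E$; it is a star operation of finite character on $R$.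 For $g\in R[X]$, $c(g)$ is the ideal of $R$ generated by the coefficients of $g$; for an ideal $Q$ of $R[X]$, $c(Q)$ is the ideal of $R$ generated by the coefficients of all elements of $Q$. By convention $(0)^{\bar{*}}=(0)$ (relevant only for $g=0$). *)

theory Defs
  imports "HOL-Computational_Algebra.Computational_Algebra"
begin

text \<open>
  An integral domain \<open>D\<close> is a type of class \<^class>\<open>idom\<close>, and its quotient field is the type
  \<open>'d fract\<close>; inside the latter, \<open>D\<close> is the set \<open>range to_fract\<close>.
  The quotient field is a \<open>D\<close>-module via \<open>frac_scale\<close>, and \<open>D\<close> is a module over itself via \<open>(*)\<close>.
\<close>

abbreviation frac_scale :: "'d::idom \<Rightarrow> 'd fract \<Rightarrow> 'd fract" where
  "frac_scale d x \<equiv> to_fract d * x"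

lemma module_frac_scale: "module (frac_scale :: 'd::idom \<Rightarrow> 'd fract \<Rightarrow> 'd fract)"
  by unfold_locales (simp_all add: algebra_simps)

lemma module_self: "module ((*) :: 'd::idom \<Rightarrow> 'd \<Rightarrow> 'd)"
  by unfold_locales (simp_all add: algebra_simps)

text \<open>The sets \<open>bar F(D)\<close>, \<open>F(D)\<close> and \<open>f(D)\<close>, respectively.\<close>

definition frac_submodules :: "'d::idom fract set set" where
  "frac_submodules = {E. module.subspace frac_scale E \<and> E \<noteq> {0}}"

definition fractional_ideals :: "'d::idom fract set set" where
  "fractional_ideals =
     {E \<in> frac_submodules. \<exists>d. d \<noteq> 0 \<and> frac_scale d ` E \<subseteq> range to_fract}"

definition fg_submodules :: "'d::idom fract set set" where
  "fg_submodules = {E \<in> frac_submodules. \<exists>S. finite S \<and> E = module.span frac_scale S}"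

definition semistar_operation :: "('d::idom fract set \<Rightarrow> 'd fract set) \<Rightarrow> bool" where
  "semistar_operation star \<longleftrightarrow>
     (\<forall>E\<in>frac_submodules. star E \<in> frac_submodules) \<and>
     (\<forall>E\<in>frac_submodules. \<forall>a. a \<noteq> 0 \<longrightarrow> star ((*) a ` E) = (*) a ` star E) \<and>
     (\<forall>E\<in>frac_submodules. E \<subseteq> star E) \<and>
     (\<forall>E\<in>frac_submodules. \<forall>F\<in>frac_submodules. E \<subseteq> F \<longrightarrow> star E \<subseteq> star F) \<and>
     (\<forall>E\<in>frac_submodules. star (star E) = star E)"

text \<open>
  A star operation is a map on \<^const>\<open>fractional_ideals\<close>; its values elsewhere are junk, and
  no statement may depend on them.
\<close>

definition star_operation :: "('d::idom fract set \<Rightarrow> 'd fract set) \<Rightarrow> bool" where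
  "star_operation star \<longleftrightarrow>
     (\<exists>semistar. semistar_operation semistar \<and>
        semistar (range to_fract) = range to_fract \<and>
        (\<forall>E\<in>fractional_ideals. star E = semistar E))"

definition finite_character :: "('d::idom fract set \<Rightarrow> 'd fract set) \<Rightarrow> bool" where
  "finite_character star \<longleftrightarrow>
     (\<forall>E\<in>fractional_ideals. star E = \<Union> {star F | F. F \<in> fg_submodules \<and> F \<subseteq> E})"

text \<open>Integral ideals are kept as subsets of the ring and moved to the quotient field by \<open>to_fract\<close>.\<close>

abbreviation is_ideal :: "'d::idom set \<Rightarrow> bool" where
  "is_ideal \<equiv> module.subspace (*)"

definition is_prime_ideal :: "'d::idom set \<Rightarrow> bool" where
  "is_prime_ideal P \<longleftrightarrow>
     is_ideal P \<and> P \<noteq> UNIV \<and> (\<forall>a b. a * b \<in> P \<longrightarrow> a \<in> P \<or> b \<in> P)"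

definition star_ideal :: "('d::idom fract set \<Rightarrow> 'd fract set) \<Rightarrow> 'd set \<Rightarrow> bool" where
  "star_ideal star I \<longleftrightarrow> is_ideal I \<and> I \<noteq> {0} \<and> star (to_fract ` I) = to_fract ` I"

definition star_prime_ideal :: "('d::idom fract set \<Rightarrow> 'd fract set) \<Rightarrow> 'd set \<Rightarrow> bool" where
  "star_prime_ideal star P \<longleftrightarrow> is_prime_ideal P \<and> star_ideal star P"

definition star_maximal_ideal :: "('d::idom fract set \<Rightarrow> 'd fract set) \<Rightarrow> 'd set \<Rightarrow> bool" where
  "star_maximal_ideal star M \<longleftrightarrow>
     star_prime_ideal star M \<and> (\<forall>P. star_prime_ideal star P \<and> M \<subseteq> P \<longrightarrow> P = M)"

text \<open>
  For \<open>R\<close> the type \<open>'a\<close> with quotient field \<open>K\<close>, the quotient field of \<open>R[X]\<close> is the type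
  \<open>'a poly fract\<close>.  The map \<open>const_fract\<close> is the inclusion of \<open>K\<close> into it, and \<open>poly_fract\<close> extends
  that to the inclusion of \<open>K[X]\<close>, by evaluation at \<open>X\<close>.
\<close>

definition const_fract :: "'a::idom fract \<Rightarrow> 'a poly fract" where
  "const_fract x = (THE y. \<exists>a b. b \<noteq> 0 \<and> x = Fract a b \<and> y = Fract [:a:] [:b:])"

lemma const_fract_Fract: "b \<noteq> 0 \<Longrightarrow> const_fract (Fract a b) = Fract [:a:] [:b:]"
  unfolding const_fract_def
  by (rule the_equality) (auto simp: eq_fract mult.commute)

lemma const_fract_to_fract [simp]: "const_fract (to_fract a) = to_fract [:a:]"
  by (simp add: const_fract_Fract to_fract_def one_pCons)

lemma const_fract_0 [simp]: "const_fract 0 = 0"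
  using const_fract_to_fract [of 0] by simp

definition poly_fract :: "'a::idom fract poly \<Rightarrow> 'a poly fract" where
  "poly_fract p = poly (map_poly const_fract p) (to_fract [:0, 1:])"

lemma poly_fract_fract_poly: "poly_fract (fract_poly p) = to_fract p"
proof (induction p)
  case 0
  then show ?case by (simp add: poly_fract_def)
next
  case (pCons a p)
  have "pCons a p = [:a:] + [:0, 1:] * p" by simp
  then have "to_fract (pCons a p) = to_fract [:a:] + to_fract [:0, 1:] * to_fract p"
    by (metis to_fract_add to_fract_mult)
  then show ?case
    using pCons by (simp add: poly_fract_def map_poly_pCons)
qed

text \<open>\<open>polys_over E\<close> is \<open>E[X]\<close>.\<close>

definition polys_over :: "'b::zero set \<Rightarrow> 'b poly set" where
  "polys_over E = {p. \<forall>i. coeff p i \<in> E}"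

text \<open>
  The inverse image under \<^const>\<open>const_fract\<close> is the intersection with \<open>K\<close>.  The first branch is the
  convention for the zero ideal, which is not in the domain of a star operation.
\<close>

definition induced_star ::
    "('a::idom poly fract set \<Rightarrow> 'a poly fract set) \<Rightarrow> 'a fract set \<Rightarrow> 'a fract set" where
  "induced_star star E =
     (if E = {0} then {0} else const_fract -` star (poly_fract ` polys_over E))"

definition content_ideal :: "'a::idom poly set \<Rightarrow> 'a set" where
  "content_ideal G = module.span (*) (\<Union>g\<in>G. range (coeff g))"

end

theory Submission
  imports Defs
begin

text \<open>
  For a nonzero integral ideal \<open>I\<close> of a domain \<open>D\<close> the set \<open>I\<^sup>*\<close> lies in \<open>D\<^sup>* = D\<close>, so a star
  operation restricts to a closure operator on the nonzero ideals of \<open>D\<close>, and \<open>I\<^sup>* = D\<close> says that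
  \<open>1 \<in> I\<^sup>*\<close>.  As \<open>K \<inter> R[X] = R\<close>, a nonzero ideal \<open>J\<close> of \<open>R\<close> has proper closure under the induced
  operation iff \<open>1 \<notin> (J[X])\<^sup>*\<close> (\<open>induced_star_proper_iff\<close>).  Conditions (ii) and (iii) thus
  concern closures of extended ideals in \<open>R[X]\<close>.

  If \<open>Q = q[X]\<close>, then \<open>c(Q) \<subseteq> q\<close>, so \<open>c(Q)[X] \<subseteq> Q\<close>, and \<open>Q = Q\<^sup>*\<close> is proper.  Conversely, always
  \<open>Q \<subseteq> c(Q)[X]\<close>; if the closure of the latter is proper, it lies in a star-prime ideal
  (\<open>proper_closure_imp_star_prime\<close>, by Zorn's lemma), which must be \<open>Q\<close> by
  maximality.  Hence \<open>c(Q)[X] = Q\<close>, and the coefficients of elements of \<open>Q\<close> lie in \<open>q\<close>.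

  The content of a single \<open>g \<in> Q\<close> is contained in \<open>c(Q)\<close>, so that (ii) implies (iii).  For the
  converse, \<open>1 \<in> (c(Q)[X])\<^sup>*\<close> is by finite character witnessed by finitely many polynomials, hence by
  finitely many elements of \<open>c(Q)\<close>.  These all lie in the content of one element of \<open>Q\<close>
  (\<open>finite_subset_content_ideal\<close>), because \<open>g + X\<^sup>n h\<close> with \<open>n > deg g\<close> has the coefficients of
  both \<open>g\<close> and \<open>h\<close>.
\<close>

interpretation self: module "(*) :: 'd::idom \<Rightarrow> 'd \<Rightarrow> 'd"
  by (rule module_self)

interpretation frac: module "frac_scale :: 'd::idom \<Rightarrow> 'd fract \<Rightarrow> 'd fract"
  by (rule module_frac_scale)

text \<open>As simplification rules, these loop with \<open>mult.assoc\<close>.\<close>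
declare self.scale_scale [simp del] frac.scale_scale [simp del]

section \<open>Integral ideals inside the quotient field\<close>

lemma subspace_to_fract_image:
  assumes "is_ideal I"
  shows "frac.subspace (to_fract ` I)"
  unfolding frac.subspace_def
proof (intro conjI ballI allI)
  show "0 \<in> to_fract ` I"
    using self.subspace_0[OF assms] by (metis imageI to_fract_0)
next
  fix x y assume "x \<in> to_fract ` I" "y \<in> to_fract ` I"
  then show "x + y \<in> to_fract ` I"
    using self.subspace_add[OF assms] by (auto simp flip: to_fract_add)
next
  fix c x assume "x \<in> to_fract ` I"
  then show "to_fract c * x \<in> to_fract ` I"
    using self.subspace_scale[OF assms] by (auto simp flip: to_fract_mult)
qed

lemma is_ideal_to_fract_vimage:
  assumes "frac.subspace E"
  shows "is_ideal (to_fract -` E)"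
  using frac.subspace_0[OF assms] frac.subspace_add[OF assms] frac.subspace_scale[OF assms]
  unfolding self.subspace_def by auto

lemma to_fract_image_eq_0_iff: "to_fract ` I = {0} \<longleftrightarrow> I = {0}"
proof
  assume *: "to_fract ` I = {0}"
  then have "I \<subseteq> {0}" by (metis imageI singletonD subsetI to_fract_eq_0_iff singletonI)
  with * show "I = {0}" by (metis image_is_empty insert_not_empty subset_singletonD)
qed auto

lemma frac_submodule_in_ring_is_fractional:
  assumes "E \<in> frac_submodules" "E \<subseteq> range to_fract"
  shows "E \<in> fractional_ideals"
  using assms unfolding fractional_ideals_def
  by (auto intro!: exI[of _ 1] simp: image_subset_iff)

lemma to_fract_image_fractional:
  assumes "is_ideal I" "I \<noteq> {0}"
  shows "to_fract ` I \<in> fractional_ideals"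
  using assms subspace_to_fract_image[OF assms(1)]
  by (intro frac_submodule_in_ring_is_fractional)
     (auto simp: frac_submodules_def to_fract_image_eq_0_iff)

lemma is_ideal_mult_image:
  assumes "is_ideal I"
  shows "is_ideal ((*) b ` I)"
  unfolding self.subspace_def
proof (intro conjI ballI allI)
  show "0 \<in> (*) b ` I"
    using self.subspace_0[OF assms] by (metis imageI mult_zero_right)
next
  fix x y assume "x \<in> (*) b ` I" "y \<in> (*) b ` I"
  then obtain u v where "u \<in> I" "v \<in> I" "x = b * u" "y = b * v" by auto
  then show "x + y \<in> (*) b ` I"
    using self.subspace_add[OF assms] by (metis imageI distrib_left)
next
  fix c x assume "x \<in> (*) b ` I"
  then obtain u where "u \<in> I" "x = b * u" by auto
  then show "c * x \<in> (*) b ` I"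
    using self.subspace_scale[OF assms] by (metis imageI mult.left_commute)
qed

lemma mult_image_nonzero:
  fixes b :: "'d::idom"
  assumes "is_ideal I" "I \<noteq> {0}" "b \<noteq> 0"
  shows "(*) b ` I \<noteq> {0}"
proof -
  obtain x where "x \<in> I" "x \<noteq> 0" using assms(1,2) self.subspace_0 by blast
  then have "b * x \<in> (*) b ` I" "b * x \<noteq> 0" using assms(3) by auto
  then show ?thesis by blast
qed

section \<open>The closure of integral ideals under a star operation\<close>

locale finite_star =
  fixes star :: "'d::idom fract set \<Rightarrow> 'd fract set"
  assumes star: "star_operation star" and fin: "finite_character star"
begin

text \<open>
  For a nonzero ideal \<open>I\<close> the intersection with the ring loses nothing, by \<open>star_subset_ring\<close>; it
  allows closures to be handled as ideals of the ring itself.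
\<close>

definition cl :: "'d set \<Rightarrow> 'd set" where
  "cl I = to_fract -` star (to_fract ` I)"

lemma obtain_semistar:
  obtains sstar where "semistar_operation sstar" "sstar (range to_fract) = range to_fract"
    "\<And>E. E \<in> fractional_ideals \<Longrightarrow> E \<in> frac_submodules \<and> star E = sstar E"
  using star unfolding star_operation_def fractional_ideals_def by blast

lemma star_mono:
  assumes "E \<in> fractional_ideals" "F \<in> fractional_ideals" "E \<subseteq> F"
  shows "star E \<subseteq> star F"
  by (rule obtain_semistar) (use assms in \<open>simp add: semistar_operation_def\<close>)

context
  fixes I :: "'d set"
  assumes I: "is_ideal I" "I \<noteq> {0}"
begin

lemma star_submodule: "star (to_fract ` I) \<in> frac_submodules"
  by (rule obtain_semistar)
     (use to_fract_image_fractional[OF I] in \<open>simp add: semistar_operation_def\<close>)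

lemma star_subset_ring: "star (to_fract ` I) \<subseteq> range to_fract"
proof -
  have U: "is_ideal (UNIV :: 'd set)" "(UNIV :: 'd set) \<noteq> {0}"
    using self.subspace_UNIV by (auto simp: set_eq_iff intro: exI[of _ 1])
  have "star (range to_fract) = range to_fract"
    by (rule obtain_semistar) (use to_fract_image_fractional[OF U] in simp)
  then show ?thesis
    using star_mono[OF to_fract_image_fractional[OF I] to_fract_image_fractional[OF U]] by auto
qed

lemma to_fract_cl: "to_fract ` cl I = star (to_fract ` I)"
  unfolding cl_def using star_subset_ring by auto

lemma is_ideal_cl: "is_ideal (cl I)"
  unfolding cl_def using star_submodule
  by (intro is_ideal_to_fract_vimage) (simp add: frac_submodules_def)

lemma subset_cl: "I \<subseteq> cl I"
proof -
  have "to_fract ` I \<subseteq> star (to_fract ` I)"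
    by (rule obtain_semistar)
       (use to_fract_image_fractional[OF I] in \<open>simp add: semistar_operation_def\<close>)
  then show ?thesis unfolding cl_def by auto
qed

lemma cl_nonzero: "cl I \<noteq> {0}"
  using subset_cl I self.subspace_0 by blast

lemma star_ideal_cl: "star_ideal star (cl I)"
proof -
  have "star (to_fract ` cl I) = to_fract ` cl I"
  proof (rule obtain_semistar)
    fix sstar
    assume sstar: "semistar_operation sstar"
      "\<And>E. E \<in> fractional_ideals \<Longrightarrow> E \<in> frac_submodules \<and> star E = sstar E"
    have "star (to_fract ` cl I) = sstar (star (to_fract ` I))"
      using sstar(2) to_fract_image_fractional[OF is_ideal_cl cl_nonzero] to_fract_cl by simp
    also have "\<dots> = star (to_fract ` I)"
      using sstar to_fract_image_fractional[OF I] by (simp add: semistar_operation_def)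
    finally show ?thesis by (simp add: to_fract_cl)
  qed
  then show ?thesis
    unfolding star_ideal_def using is_ideal_cl cl_nonzero to_fract_cl by auto
qed

lemma mult_mem_cl_image:
  assumes "b \<noteq> 0" "x \<in> cl I"
  shows "b * x \<in> cl ((*) b ` I)"
proof -
  have eq: "to_fract ` (*) b ` I = (*) (to_fract b) ` to_fract ` I"
    by (simp add: image_image)
  have "is_ideal ((*) b ` I)" by (rule is_ideal_mult_image[OF I(1)])
  moreover have "(*) b ` I \<noteq> {0}"
    by (rule mult_image_nonzero[OF I assms(1)])
  ultimately have frac: "to_fract ` (*) b ` I \<in> fractional_ideals"
    by (rule to_fract_image_fractional)
  have "star (to_fract ` (*) b ` I) = (*) (to_fract b) ` star (to_fract ` I)"
    by (rule obtain_semistar)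
       (use frac to_fract_image_fractional[OF I] assms(1) in \<open>simp add: eq semistar_operation_def\<close>)
  then show ?thesis
    using assms(2) unfolding cl_def by auto
qed

lemma finite_witness:
  assumes "x \<in> cl I"
  obtains T where "finite T" "T \<subseteq> I" "self.span T \<noteq> {0}" "x \<in> cl (self.span T)"
proof -
  obtain F where F: "F \<in> fg_submodules" "F \<subseteq> to_fract ` I" "to_fract x \<in> star F"
    using assms fin to_fract_image_fractional[OF I] unfolding cl_def finite_character_def by auto
  then obtain S where S: "finite S" "F = frac.span S" and Fs: "F \<in> frac_submodules"
    unfolding fg_submodules_def by auto
  have "S \<subseteq> to_fract ` I" using S(2) F(2) frac.span_superset by blast
  then obtain T where T: "finite T" "T \<subseteq> I" "S = to_fract ` T"
    using S(1) by (metis finite_subset_image)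
  have FT: "F \<subseteq> to_fract ` self.span T"
    unfolding S(2) T(3)
    by (intro frac.span_minimal subspace_to_fract_image self.subspace_span image_mono
        self.span_superset)
  have nz: "self.span T \<noteq> {0}"
  proof
    assume "self.span T = {0}"
    with FT have "F \<subseteq> {0}" by simp
    moreover have "0 \<in> F" unfolding S(2) by (rule frac.span_zero)
    ultimately show False using Fs unfolding frac_submodules_def by blast
  qed
  have "star F \<subseteq> star (to_fract ` self.span T)"
    using F(2) Fs FT nz
    by (intro star_mono frac_submodule_in_ring_is_fractional to_fract_image_fractional
        self.subspace_span) auto
  then show ?thesis
    using that[OF T(1,2) nz] F(3) unfolding cl_def by blast
qed

end

lemma cl_mono:
  assumes "is_ideal I" "I \<noteq> {0}" "is_ideal J" "I \<subseteq> J"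
  shows "cl I \<subseteq> cl J"
proof -
  have "J \<noteq> {0}" using assms self.subspace_0 by blast
  then have "star (to_fract ` I) \<subseteq> star (to_fract ` J)"
    using assms by (intro star_mono to_fract_image_fractional) auto
  then show ?thesis unfolding cl_def by auto
qed

lemma star_ideal_iff: "star_ideal star I \<longleftrightarrow> is_ideal I \<and> I \<noteq> {0} \<and> cl I = I"
proof -
  have "star (to_fract ` I) = to_fract ` I \<longleftrightarrow> cl I = I" if "is_ideal I" "I \<noteq> {0}"
    using to_fract_cl[OF that] inj_image_eq_iff[of to_fract "cl I" I]
    by (simp add: inj_on_def)
  then show ?thesis unfolding star_ideal_def by auto
qed

text \<open>
  By finite character an element of the closure of the union is already in the closure of finitely
  many elements, and these lie in one member of the chain.
\<close>

lemma star_ideal_Union_chain: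
  assumes C: "C \<noteq> {}" "\<And>I. I \<in> C \<Longrightarrow> star_ideal star I"
    and chain: "\<And>I J. I \<in> C \<Longrightarrow> J \<in> C \<Longrightarrow> I \<subseteq> J \<or> J \<subseteq> I"
  shows "star_ideal star (\<Union>C)"
proof -
  have id: "is_ideal I" if "I \<in> C" for I using C(2)[OF that] by (simp add: star_ideal_iff)
  have fin_sub: "\<exists>I\<in>C. T \<subseteq> I" if "finite T" "T \<subseteq> \<Union>C" for T
    using that
  proof induction
    case empty
    then show ?case using C(1) by auto
  next
    case (insert x T)
    then obtain I J where "I \<in> C" "T \<subseteq> I" "J \<in> C" "x \<in> J" by auto
    with chain[of I J] show ?case by blast
  qed
  have ideal: "is_ideal (\<Union>C)"
    unfolding self.subspace_def
  proof (intro conjI ballI allI)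
    show "0 \<in> \<Union>C" using C(1) id self.subspace_0 by blast
  next
    fix x y assume "x \<in> \<Union>C" "y \<in> \<Union>C"
    then obtain I where "I \<in> C" "{x, y} \<subseteq> I" using fin_sub[of "{x, y}"] by auto
    then show "x + y \<in> \<Union>C" using self.subspace_add[OF id] by blast
  next
    fix c x assume "x \<in> \<Union>C"
    then show "c * x \<in> \<Union>C" using self.subspace_scale[OF id] by blast
  qed
  obtain I where I: "I \<in> C" using C(1) by auto
  then have nz: "\<Union>C \<noteq> {0}"
    using C(2)[OF I] self.subspace_0[OF id[OF I]] unfolding star_ideal_iff by blast
  have "cl (\<Union>C) \<subseteq> \<Union>C"
  proof
    fix x assume "x \<in> cl (\<Union>C)"
    then obtain T where T: "finite T" "T \<subseteq> \<Union>C" "self.span T \<noteq> {0}" "x \<in> cl (self.span T)"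
      using finite_witness[OF ideal nz] by metis
    then obtain J where J: "J \<in> C" "T \<subseteq> J" using fin_sub by blast
    have "cl (self.span T) \<subseteq> cl J"
      using T(3) J by (intro cl_mono self.subspace_span self.span_minimal id) auto
    with T(4) C(2)[OF J(1)] J(1) show "x \<in> \<Union>C" by (auto simp: star_ideal_iff)
  qed
  then show ?thesis using ideal nz subset_cl[OF ideal nz] by (auto simp: star_ideal_iff)
qed

text \<open>
  If \<open>a b \<in> P\<close> but \<open>a \<notin> P\<close>, then \<open>1 \<in> (P + a D)\<^sup>*\<close> by maximality; multiplication by \<open>b\<close> moves
  \<open>P + a D\<close> into \<open>P\<close>, so \<open>b \<in> P\<^sup>* = P\<close>.
\<close>

lemma maximal_proper_star_ideal_is_prime:
  assumes P: "star_ideal star P" "1 \<notin> P"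
    and max: "\<And>I. star_ideal star I \<Longrightarrow> 1 \<notin> I \<Longrightarrow> P \<subseteq> I \<Longrightarrow> I = P"
  shows "is_prime_ideal P"
proof -
  have P': "is_ideal P" "P \<noteq> {0}" "cl P = P" using P(1) by (auto simp: star_ideal_iff)
  have "b \<in> P" if ab: "a * b \<in> P" "a \<notin> P" for a b
  proof (cases "b = 0")
    case True
    then show ?thesis using self.subspace_0[OF P'(1)] by simp
  next
    case False
    define I where "I = {x + y * a | x y. x \<in> P}"
    have mem_I: "x + y * a \<in> I" if "x \<in> P" for x y
      unfolding I_def using that by blast
    have PI: "P \<subseteq> I" using mem_I[of _ 0] by auto
    have aI: "a \<in> I" using mem_I[OF self.subspace_0[OF P'(1)], of 1] by simp
    have I: "is_ideal I"
      unfolding self.subspace_def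
    proof (intro conjI ballI allI)
      show "0 \<in> I" using PI self.subspace_0[OF P'(1)] by blast
    next
      fix u v assume "u \<in> I" "v \<in> I"
      then obtain x y x' y' where "x \<in> P" "x' \<in> P" and uv: "u = x + y * a" "v = x' + y' * a"
        unfolding I_def by auto
      then have "x + x' \<in> P" using self.subspace_add[OF P'(1)] by blast
      then have "(x + x') + (y + y') * a \<in> I" by (rule mem_I)
      then show "u + v \<in> I" unfolding uv by (simp add: algebra_simps)
    next
      fix c u assume "u \<in> I"
      then obtain x y where "x \<in> P" and u: "u = x + y * a" unfolding I_def by auto
      then have "c * x \<in> P" using self.subspace_scale[OF P'(1)] by blast
      then have "c * x + (c * y) * a \<in> I" by (rule mem_I)
      then show "c * u \<in> I" unfolding u by (simp add: algebra_simps)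
    qed
    have Inz: "I \<noteq> {0}"
      using aI ab(2) self.subspace_0[OF P'(1)] by (metis singletonD)
    have "1 \<in> cl I"
    proof (rule ccontr)
      assume "1 \<notin> cl I"
      then have "cl I = P"
        by (rule max[OF star_ideal_cl[OF I Inz] _ order.trans[OF PI subset_cl[OF I Inz]]])
      then show False using aI subset_cl[OF I Inz] ab(2) by auto
    qed
    then have b: "b * 1 \<in> cl ((*) b ` I)" by (rule mult_mem_cl_image[OF I Inz False])
    have ideal: "is_ideal ((*) b ` I)" by (rule is_ideal_mult_image[OF I])
    have nz: "(*) b ` I \<noteq> {0}"
      by (rule mult_image_nonzero[OF I Inz False])
    have "(*) b ` I \<subseteq> P"
    proof
      fix z assume "z \<in> (*) b ` I"
      then obtain x y where x: "x \<in> P" and "z = b * (x + y * a)" unfolding I_def by auto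
      then have z: "z = b * x + y * (a * b)" by (simp add: algebra_simps)
      show "z \<in> P"
        unfolding z using self.subspace_add[OF P'(1)] self.subspace_scale[OF P'(1)] x ab(1)
        by blast
    qed
    then show ?thesis using b cl_mono[OF ideal nz P'(1)] P'(3) by auto
  qed
  then show ?thesis using P' P(2) unfolding is_prime_ideal_def by auto
qed

lemma proper_closure_imp_star_prime:
  assumes J: "is_ideal J" "J \<noteq> {0}" "1 \<notin> cl J"
  obtains P where "star_prime_ideal star P" "J \<subseteq> P"
proof -
  define A where "A = {I. star_ideal star I \<and> 1 \<notin> I \<and> J \<subseteq> I}"
  have cl: "cl J \<in> A" unfolding A_def using J star_ideal_cl subset_cl by auto
  have "\<exists>P\<in>A. \<forall>I\<in>A. P \<subseteq> I \<longrightarrow> I = P"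
  proof (rule subset_Zorn)
    fix C assume C: "subset.chain A C"
    show "\<exists>U\<in>A. \<forall>X\<in>C. X \<subseteq> U"
    proof (cases "C = {}")
      case True
      then show ?thesis using cl by auto
    next
      case False
      have "star_ideal star (\<Union>C)"
        using C unfolding subset_chain_def A_def
        by (intro star_ideal_Union_chain False) auto
      then have "\<Union>C \<in> A" using C False unfolding subset_chain_def A_def by blast
      then show ?thesis by blast
    qed
  qed
  then obtain P where P: "P \<in> A" and max: "\<And>I. I \<in> A \<Longrightarrow> P \<subseteq> I \<Longrightarrow> I = P" by blast
  then have "is_prime_ideal P"
    by (intro maximal_proper_star_ideal_is_prime) (auto simp: A_def)
  then show ?thesis using that P unfolding A_def star_prime_ideal_def by blast
qed

end

section \<open>Contents and extended ideals\<close>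

lemma is_ideal_polys_over:
  assumes "is_ideal (J :: 'a::idom set)"
  shows "is_ideal (polys_over J)"
  unfolding self.subspace_def polys_over_def
  using self.subspace_0[OF assms] self.subspace_add[OF assms] self.subspace_scale[OF assms]
  by (auto simp: coeff_mult intro!: self.subspace_sum[OF assms])

lemma const_in_polys_over:
  assumes "0 \<in> J"
  shows "[:x:] \<in> polys_over J \<longleftrightarrow> x \<in> J"
  using assms by (auto simp: polys_over_def coeff_pCons split: nat.splits)

lemma polys_over_nonzero:
  assumes "is_ideal J" "J \<noteq> {0}"
  shows "polys_over J \<noteq> {0}"
proof -
  obtain x where "x \<in> J" "x \<noteq> 0" using assms self.subspace_0 by blast
  then show ?thesis
    using const_in_polys_over[OF self.subspace_0[OF assms(1)], of x] by auto
qed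

lemma is_ideal_content_ideal: "is_ideal (content_ideal G)"
  unfolding content_ideal_def by (rule self.subspace_span)

lemma subset_polys_over_content_ideal: "G \<subseteq> polys_over (content_ideal G)"
  unfolding content_ideal_def polys_over_def by (auto intro!: self.span_base)

lemma content_ideal_subset:
  assumes "is_ideal J" "G \<subseteq> polys_over J"
  shows "content_ideal G \<subseteq> J"
  unfolding content_ideal_def using assms
  by (intro self.span_minimal) (auto simp: polys_over_def)

lemma content_ideal_mono: "G \<subseteq> H \<Longrightarrow> content_ideal G \<subseteq> content_ideal H"
  unfolding content_ideal_def by (intro self.span_mono) auto

lemma content_ideal_eq_0_iff: "content_ideal G = {0} \<longleftrightarrow> G \<subseteq> {0}"
proof
  assume "content_ideal G = {0}"
  then show "G \<subseteq> {0}"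
    using subset_polys_over_content_ideal[of G] by (auto simp: polys_over_def poly_eq_iff)
next
  assume "G \<subseteq> {0}"
  then have "content_ideal G \<subseteq> {0}"
    by (intro content_ideal_subset) (auto simp: polys_over_def)
  then show "content_ideal G = {0}"
    using self.subspace_0[OF is_ideal_content_ideal] by blast
qed

text \<open>The two summands of \<open>g + X\<^sup>n h\<close> with \<open>n > deg g\<close> involve disjoint sets of powers of \<open>X\<close>.\<close>

lemma content_ideal_directed:
  assumes "is_ideal Q" "g \<in> Q" "h \<in> Q"
  obtains k where "k \<in> Q" "content_ideal {g} \<subseteq> content_ideal {k}"
    "content_ideal {h} \<subseteq> content_ideal {k}"
proof -
  define n where "n = Suc (degree g)"
  define k where "k = g + monom 1 n * h"
  have k: "coeff k i \<in> content_ideal {k}" for i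
    using subset_polys_over_content_ideal[of "{k}"] by (auto simp: polys_over_def)
  have "coeff g i \<in> content_ideal {k}" for i
  proof (cases "i \<le> degree g")
    case True
    then have "coeff g i = coeff k i" by (simp add: k_def n_def coeff_monom_mult)
    then show ?thesis using k by simp
  next
    case False
    then show ?thesis
      using self.subspace_0[OF is_ideal_content_ideal] by (simp add: coeff_eq_0)
  qed
  moreover have "coeff h i \<in> content_ideal {k}" for i
  proof -
    have "coeff h i = coeff k (n + i)" by (simp add: k_def n_def coeff_monom_mult coeff_eq_0)
    then show ?thesis using k by simp
  qed
  moreover have "k \<in> Q"
    unfolding k_def using assms self.subspace_add self.subspace_scale by blast
  ultimately show ?thesis
    by (intro that content_ideal_subset is_ideal_content_ideal) (auto simp: polys_over_def)
qed

lemma finite_subset_content_ideal: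
  assumes Q: "is_ideal Q" and A: "finite A" "A \<subseteq> content_ideal Q"
  obtains g where "g \<in> Q" "A \<subseteq> content_ideal {g}"
proof -
  define U where "U = (\<Union>g\<in>Q. content_ideal {g})"
  have "is_ideal U"
    unfolding self.subspace_def
  proof (intro conjI ballI allI)
    show "0 \<in> U"
      unfolding U_def using self.subspace_0[OF Q] self.subspace_0[OF is_ideal_content_ideal]
      by blast
  next
    fix x y assume "x \<in> U" "y \<in> U"
    then obtain g h where gh: "g \<in> Q" "h \<in> Q" "x \<in> content_ideal {g}" "y \<in> content_ideal {h}"
      unfolding U_def by auto
    obtain k where "k \<in> Q" "content_ideal {g} \<subseteq> content_ideal {k}"
      "content_ideal {h} \<subseteq> content_ideal {k}"
      using content_ideal_directed[OF Q gh(1,2)] by blast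
    then show "x + y \<in> U"
      unfolding U_def using gh self.subspace_add[OF is_ideal_content_ideal[of "{k}"]] by blast
  next
    fix c x assume "x \<in> U"
    then show "c * x \<in> U"
      unfolding U_def using self.subspace_scale[OF is_ideal_content_ideal] by blast
  qed
  moreover have "Q \<subseteq> polys_over U"
    unfolding U_def using subset_polys_over_content_ideal by (fastforce simp: polys_over_def)
  ultimately have "A \<subseteq> U" using A(2) content_ideal_subset by blast
  with A(1) have "\<exists>g\<in>Q. A \<subseteq> content_ideal {g}"
  proof induction
    case empty
    then show ?case using self.subspace_0[OF Q] by auto
  next
    case (insert x A)
    then obtain g h where gh: "g \<in> Q" "h \<in> Q" "A \<subseteq> content_ideal {g}" "x \<in> content_ideal {h}"
      unfolding U_def by auto
    obtain k where "k \<in> Q" "content_ideal {g} \<subseteq> content_ideal {k}"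
      "content_ideal {h} \<subseteq> content_ideal {k}"
      using content_ideal_directed[OF Q gh(1,2)] by blast
    then show ?case using gh(3,4) by blast
  qed
  then show ?thesis using that by blast
qed

section \<open>The induced star operation\<close>

lemma poly_fract_polys_over:
  assumes "0 \<in> J"
  shows "poly_fract ` polys_over (to_fract ` J) = to_fract ` polys_over J"
proof -
  have "polys_over (to_fract ` J) = fract_poly ` polys_over J"
  proof
    show "fract_poly ` polys_over J \<subseteq> polys_over (to_fract ` J)"
      by (auto simp: polys_over_def coeff_map_poly)
    show "polys_over (to_fract ` J) \<subseteq> fract_poly ` polys_over J"
    proof
      fix p assume p: "p \<in> polys_over (to_fract ` J)"
      define f where "f = inv_into J to_fract"
      have f: "f (coeff p i) \<in> J" "to_fract (f (coeff p i)) = coeff p i" for i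
        using p unfolding f_def polys_over_def
        by (auto intro: inv_into_into f_inv_into_f)
      have "f 0 = 0"
        unfolding f_def using assms inv_into_f_f[of to_fract J 0] by (simp add: inj_on_def)
      then have "p = fract_poly (map_poly f p)" "map_poly f p \<in> polys_over J"
        using f by (auto simp: poly_eq_iff coeff_map_poly polys_over_def)
      then show "p \<in> fract_poly ` polys_over J" by blast
    qed
  qed
  then show ?thesis by (simp add: image_image poly_fract_fract_poly)
qed

text \<open>This is \<open>K \<inter> R[X] = R\<close>: if \<open>a / b = p\<close>, then \<open>a = b p\<^sub>0\<close> for the constant term \<open>p\<^sub>0\<close> of \<open>p\<close>.\<close>

lemma const_fract_in_ring:
  assumes "const_fract x \<in> range to_fract"
  shows "x \<in> range to_fract"
proof -
  obtain p where p: "const_fract x = to_fract p" using assms by auto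
  obtain a b where x: "x = Fract a b" "b \<noteq> 0" by (cases x) auto
  with p have "[:a:] = [:b:] * p"
    by (simp add: const_fract_Fract to_fract_def eq_fract mult.commute)
  then have "a = b * coeff p 0" by (simp add: poly_eq_iff) (metis coeff_pCons_0)
  then have "x = to_fract (coeff p 0)"
    using x by (simp add: to_fract_def eq_fract mult.commute)
  then show ?thesis by blast
qed

lemma induced_star_proper_iff:
  fixes star :: "'a::idom poly fract set \<Rightarrow> 'a poly fract set"
  assumes "finite_star star" and J: "is_ideal J" "J \<noteq> {0}"
  shows "induced_star star (to_fract ` J) \<subset> range to_fract \<longleftrightarrow>
    1 \<notin> finite_star.cl star (polys_over J)"
proof -
  interpret finite_star star by fact
  note JX = is_ideal_polys_over[OF J(1)] polys_over_nonzero[OF J]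
  have eq: "induced_star star (to_fract ` J) = const_fract -` to_fract ` cl (polys_over J)"
    unfolding induced_star_def using J poly_fract_polys_over[OF self.subspace_0[OF J(1)]]
    by (simp add: to_fract_image_eq_0_iff to_fract_cl[OF JX])
  have sub: "induced_star star (to_fract ` J) \<subseteq> range to_fract"
    unfolding eq using const_fract_in_ring by blast
  have mem: "to_fract r \<in> induced_star star (to_fract ` J) \<longleftrightarrow> [:r:] \<in> cl (polys_over J)" for r
    unfolding eq by (auto simp: image_iff)
  have "1 \<in> cl (polys_over J) \<longleftrightarrow> (\<forall>r. [:r:] \<in> cl (polys_over J))"
    using self.subspace_scale[OF is_ideal_cl[OF JX], of 1]
    by (metis mult.right_neutral one_pCons)
  then show ?thesis using sub mem by blast
qed

theorem proposition2p3:
  fixes star :: "'a::idom poly fract set \<Rightarrow> 'a poly fract set"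
    and Q :: "'a poly set"
    and q :: "'a set"
  assumes "star_operation star"
    and "finite_character star"
    and "star_maximal_ideal star Q"
    and "q = {r. [:r:] \<in> Q}"
    and "q \<noteq> {0}"
  shows "(Q = polys_over q \<longleftrightarrow>
            induced_star star (to_fract ` content_ideal Q) \<subset> range to_fract) \<and>
         (induced_star star (to_fract ` content_ideal Q) \<subset> range to_fract \<longleftrightarrow>
            (\<forall>g\<in>Q. induced_star star (to_fract ` content_ideal {g}) \<subset> range to_fract))"
proof -
  have fs: "finite_star star" using assms(1,2) by (simp add: finite_star_def)
  then interpret finite_star star .
  have Q: "is_ideal Q" "Q \<noteq> {0}" "cl Q = Q" "Q \<noteq> UNIV"
    and max: "\<And>P. star_prime_ideal star P \<Longrightarrow> Q \<subseteq> P \<Longrightarrow> P = Q"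
    using assms(3) unfolding star_maximal_ideal_def star_prime_ideal_def star_ideal_iff
      is_prime_ideal_def by auto
  have "1 \<notin> Q" using self.subspace_scale[OF Q(1), of 1] Q(4) by auto
  let ?c = "content_ideal Q"
  have c: "is_ideal ?c" "?c \<noteq> {0}" "Q \<subseteq> polys_over ?c"
    using is_ideal_content_ideal subset_polys_over_content_ideal Q(2) self.subspace_0[OF Q(1)]
    by (auto simp: content_ideal_eq_0_iff)
  note cX = is_ideal_polys_over[OF c(1)] polys_over_nonzero[OF c(1,2)]
  note ii = induced_star_proper_iff[OF fs c(1,2)]
  have q: "is_ideal q"
  proof -
    have "[:c * r:] = [:c:] * [:r:]" "[:r + s:] = [:r:] + [:s:]" for c r s :: 'a by simp_all
    then show ?thesis
      unfolding assms(4) self.subspace_def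
      using self.subspace_0[OF Q(1)] self.subspace_add[OF Q(1)] self.subspace_scale[OF Q(1)]
      by (metis (no_types, lifting) mem_Collect_eq pCons_0_0)
  qed
  have "Q = polys_over q \<longleftrightarrow> 1 \<notin> cl (polys_over ?c)"
  proof
    assume eq: "Q = polys_over q"
    then have "?c \<subseteq> q" using q by (intro content_ideal_subset) auto
    then have "polys_over ?c \<subseteq> Q" unfolding eq by (auto simp: polys_over_def)
    then have "cl (polys_over ?c) \<subseteq> Q" using cl_mono[OF cX Q(1)] Q(3) by simp
    then show "1 \<notin> cl (polys_over ?c)" using \<open>1 \<notin> Q\<close> by blast
  next
    assume "1 \<notin> cl (polys_over ?c)"
    then obtain P where "star_prime_ideal star P" "polys_over ?c \<subseteq> P"
      using proper_closure_imp_star_prime[OF cX] by blast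
    then have eq: "polys_over ?c = Q" using max c(3) by blast
    then have "q = ?c"
      unfolding assms(4) using const_in_polys_over[OF self.subspace_0[OF c(1)]] by auto
    then show "Q = polys_over q" using eq by simp
  qed
  moreover have "1 \<notin> cl (polys_over ?c) \<longleftrightarrow>
      (\<forall>g\<in>Q. induced_star star (to_fract ` content_ideal {g}) \<subset> range to_fract)"
  proof (intro iffI ballI notI)
    fix g assume n: "1 \<notin> cl (polys_over ?c)" and g: "g \<in> Q"
    show "induced_star star (to_fract ` content_ideal {g}) \<subset> range to_fract"
    proof (cases "g = 0")
      case True
      then have "content_ideal {g} = {0}" by (simp add: content_ideal_eq_0_iff)
      moreover have "to_fract 0 \<in> range (to_fract :: 'a \<Rightarrow> 'a fract)"
        "to_fract 1 \<in> range (to_fract :: 'a \<Rightarrow> 'a fract) - {0}"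
        by (simp_all del: to_fract_0 to_fract_1)
      then have "{0} \<subset> range (to_fract :: 'a \<Rightarrow> 'a fract)"
        unfolding to_fract_0 by blast
      ultimately show ?thesis by (simp add: induced_star_def)
    next
      case False
      then have g': "is_ideal (content_ideal {g})" "content_ideal {g} \<noteq> {0}"
        by (auto simp: content_ideal_eq_0_iff is_ideal_content_ideal)
      have "polys_over (content_ideal {g}) \<subseteq> polys_over ?c"
        using content_ideal_mono[of "{g}" Q] g by (auto simp: polys_over_def)
      then have "cl (polys_over (content_ideal {g})) \<subseteq> cl (polys_over ?c)"
        by (intro cl_mono is_ideal_polys_over polys_over_nonzero g' cX(1))
      then show ?thesis using n induced_star_proper_iff[OF fs g'] by blast
    qed
  next
    assume iii: "\<forall>g\<in>Q. induced_star star (to_fract ` content_ideal {g}) \<subset> range to_fract"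
      and "1 \<in> cl (polys_over ?c)"
    then obtain T where T: "finite T" "T \<subseteq> polys_over ?c" "self.span T \<noteq> {0}"
      "1 \<in> cl (self.span T)"
      using finite_witness[OF cX] by metis
    have "finite (\<Union>t\<in>T. range (coeff t))" using T(1) by (auto simp: range_coeff)
    moreover have "(\<Union>t\<in>T. range (coeff t)) \<subseteq> ?c" using T(2) by (auto simp: polys_over_def)
    ultimately obtain g where g: "g \<in> Q" "(\<Union>t\<in>T. range (coeff t)) \<subseteq> content_ideal {g}"
      using finite_subset_content_ideal[OF Q(1)] by metis
    let ?d = "content_ideal {g}"
    have d: "is_ideal ?d" by (rule is_ideal_content_ideal)
    have sub: "self.span T \<subseteq> polys_over ?d"
      using g(2) by (intro self.span_minimal is_ideal_polys_over d) (auto simp: polys_over_def)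
    have "?d \<noteq> {0}"
    proof
      assume "?d = {0}"
      then have "self.span T \<subseteq> {0}" using sub by (auto simp: polys_over_def poly_eq_iff)
      then show False using T(3) self.span_zero by blast
    qed
    moreover have "1 \<in> cl (polys_over ?d)"
      using T(4) cl_mono[OF self.subspace_span T(3) is_ideal_polys_over[OF d] sub] by blast
    ultimately show False using iii g(1) induced_star_proper_iff[OF fs d] by blast
  qed
  ultimately show ?thesis unfolding ii by blast
qed

end
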